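(* Let $\mathcal Y_C$ be the admissible output space, $\Lambda_C:L^2(0,T;\mathbb R^m)\to\mathcal Y_C$ the control-to-output operator, $\Lambda_C^*:\mathcal Y_C'\to L^2(0,T;\mathbb R^m)$ its adjoint and $G_C=\Lambda_C\Lambda_C^*:\mathcal Y_C'\to\mathcal Y_C$ the tracking Gramian. The following assertions are equivalent: (I) The input-output system $x'(t)=Ax(t)+Bu(t)$, $x(0)=0$, $y(t)=Cx(t)$ is exactly output tracking controllable. (II) The operator $\Lambda_C:L^2(0,T;\mathbb R^m)\to\mathcal Y_C$ is surjective. (III) There exists a constant $\gamma>0$ such that $$\|\psi\|_{\mathcal Y_C'}\le\gamma\,\|\Lambda_C^*\psi\|_{L^2(0,T;\mathbb R^m)}\qquad\text{for all }\psi\in\mathcal Y_C'.$$ (IV) The tracking Gramian $G_C:\mathcal Y_C'\to\mathcal Y_C$ is invertible with continuous inverse.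
   Context: Fix $T>0$, integers $1\le m\le n$, $1\le p\le n$, and real matrices $A\in\mathbb R^{n\times n}$, $B\in\mathbb R^{n\times m}$, $C\in\mathbb R^{p\times n}$, with $C$ of full row rank. Let $\mathcal Y_C$ be a fixed real Hilbert space of output trajectories, continuously embedded in $L^2(0,T;\mathbb R^p)$, such that the control-to-output operator $$(\Lambda_C u)(t)=\int_0^t Ce^{A(t-s)}Bu(s)\,ds$$ is well defined and continuous from $L^2(0,T;\mathbb R^m)$ to $\mathcal Y_C$. (The space $\mathcal Y_C$ is prescribed a priori; it is not defined as the range of $\Lambda_C$.) Thus $\Lambda_C u=Cx$, where $x'=Ax+Bu$, $x(0)=0$. $\mathcal Y_C'$ denotes the dual of $\mathcal Y_C$, with duality pairing $\langle\cdot,\cdot\rangle_{\mathcal Y_C',\mathcal Y_C}$. $L^2(0,T;\mathbb R^m)$ is identified with its dual, and $\Lambda_C^*:\mathcal Y_C'\to L^2(0,T;\mathbb R^m)$ is the adjoint: $\langle\Lambda_C^*\psi,u\rangle_{L^2(0,T;\mathbb R^m)}=\langle\psi,\Lambda_C u\rangle_{\mathcal Y_C',\mathcal Y_C}$. The tracking Gramian is $G_C:=\Lambda_C\Lambda_C^*:\mathcal Y_C'\to\mathcal Y_C$, i.e. $\langle h,G_Cg\rangle_{\mathcal Y_C',\mathcal Y_C}=\langle\Lambda_C^*g,\Lambda_C^*h\rangle_{L^2(0,T;\mathbb R^m)}$ for $g,h\in\mathcal Y_C'$. The input-output system is called exactly output tracking controllable if $\Lambda_C:L^2(0,T;\mathbb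 R^m)\to\mathcal Y_C$ is surjective. *)

theory Defs
  imports "HOL-Analysis.Analysis"
begin

text \<open>Elements of an L2 space are represented by functions; two functions represent the same
  element iff they agree almost everywhere.\<close>

definition L2_space :: "'a measure \<Rightarrow> ('a \<Rightarrow> 'b::euclidean_space) set" where
  "L2_space M = {f. f \<in> borel_measurable M \<and> integrable M (\<lambda>x. (norm (f x))\<^sup>2)}"

definition L2_inner :: "'a measure \<Rightarrow> ('a \<Rightarrow> 'b::euclidean_space) \<Rightarrow> ('a \<Rightarrow> 'b) \<Rightarrow> real" where
  "L2_inner M f g = (\<integral>x. f x \<bullet> g x \<partial>M)"

definition L2_norm :: "'a measure \<Rightarrow> ('a \<Rightarrow> 'b::euclidean_space) \<Rightarrow> real" where
  "L2_norm M f = sqrt (\<integral>x. (norm (f x))\<^sup>2 \<partial>M)"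

abbreviation time_measure :: "real \<Rightarrow> real measure" where
  "time_measure T \<equiv> lebesgue_on {0<..<T}"

text \<open>A continuous embedding \<open>\<iota>\<close> of a normed space into L2: \<open>\<iota> y\<close> is a representative of the
  trajectory \<open>y\<close>, so linearity and injectivity hold modulo equality almost everywhere.\<close>

definition L2_embedding ::
    "'a measure \<Rightarrow> ('y::real_normed_vector \<Rightarrow> 'a \<Rightarrow> 'b::euclidean_space) \<Rightarrow> bool" where
  "L2_embedding M \<iota> \<longleftrightarrow>
     (\<forall>y. \<iota> y \<in> L2_space M) \<and>
     (\<forall>y z. AE t in M. \<iota> (y + z) t = \<iota> y t + \<iota> z t) \<and>
     (\<forall>c y. AE t in M. \<iota> (c *\<^sub>R y) t = c *\<^sub>R \<iota> y t) \<and>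
     (\<forall>y. (AE t in M. \<iota> y t = 0) \<longrightarrow> y = 0) \<and>
     (\<exists>K. \<forall>y. L2_norm M (\<iota> y) \<le> K * norm y)"

definition matrix_exp :: "real^'n^'n \<Rightarrow> real^'n^'n" where
  "matrix_exp A = (\<Sum>k. (((**) A ^^ k) (mat 1)) /\<^sub>R fact k)"

definition output_trajectory ::
    "real^'n^'n \<Rightarrow> real^'m^'n \<Rightarrow> real^'n^'p \<Rightarrow> (real \<Rightarrow> real^'m) \<Rightarrow> real \<Rightarrow> real^'p" where
  "output_trajectory A B C u t =
     (\<integral>s. (C ** matrix_exp ((t - s) *\<^sub>R A) ** B) *v u s \<partial>lebesgue_on {0<..<t})"

text \<open>The control-to-output operator as a map into the space embedded by \<open>\<iota>\<close>. The description
  denotes a unique element whenever \<open>\<iota>\<close> is an embedding whose range contains the trajectory.\<close>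

definition output_operator ::
    "real \<Rightarrow> real^'n^'n \<Rightarrow> real^'m^'n \<Rightarrow> real^'n^'p \<Rightarrow> ('y \<Rightarrow> real \<Rightarrow> real^'p)
      \<Rightarrow> (real \<Rightarrow> real^'m) \<Rightarrow> 'y" where
  "output_operator T A B C \<iota> u =
     (THE y. AE t in time_measure T. \<iota> y t = output_trajectory A B C u t)"

definition exactly_output_tracking_controllable ::
    "real \<Rightarrow> real^'n^'n \<Rightarrow> real^'m^'n \<Rightarrow> real^'n^'p \<Rightarrow> ('y \<Rightarrow> real \<Rightarrow> real^'p) \<Rightarrow> bool" where
  "exactly_output_tracking_controllable T A B C \<iota> \<longleftrightarrow>
     (\<forall>y. \<exists>u \<in> L2_space (time_measure T). output_operator T A B C \<iota> u = y)"

text \<open>The adjoint of \<open>\<Lambda>\<close> from L2 to \<open>'y\<close>, with L2 identified with its dual. The dual of \<open>'y\<close> is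
  the type of bounded functionals with the operator norm and evaluation as duality pairing. For
  bounded linear \<open>\<Lambda>\<close> the choice is only that of a representative, the element of L2 being
  determined by Riesz' theorem.\<close>

definition L2_adjoint ::
    "'a measure \<Rightarrow> (('a \<Rightarrow> 'b::euclidean_space) \<Rightarrow> 'y::real_normed_vector)
      \<Rightarrow> ('y \<Rightarrow>\<^sub>L real) \<Rightarrow> 'a \<Rightarrow> 'b" where
  "L2_adjoint M \<Lambda> \<psi> =
     (SOME v. v \<in> L2_space M \<and>
        (\<forall>u \<in> L2_space M. L2_inner M v u = blinfun_apply \<psi> (\<Lambda> u)))"

definition output_adjoint ::
    "real \<Rightarrow> real^'n^'n \<Rightarrow> real^'m^'n \<Rightarrow> real^'n^'p
      \<Rightarrow> ('y::real_normed_vector \<Rightarrow> real \<Rightarrow> real^'p) \<Rightarrow> ('y \<Rightarrow>\<^sub>L real) \<Rightarrow> real \<Rightarrow> real^'m" where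
  "output_adjoint T A B C \<iota> = L2_adjoint (time_measure T) (output_operator T A B C \<iota>)"

definition tracking_gramian ::
    "real \<Rightarrow> real^'n^'n \<Rightarrow> real^'m^'n \<Rightarrow> real^'n^'p
      \<Rightarrow> ('y::real_normed_vector \<Rightarrow> real \<Rightarrow> real^'p) \<Rightarrow> ('y \<Rightarrow>\<^sub>L real) \<Rightarrow> 'y" where
  "tracking_gramian T A B C \<iota> \<psi> = output_operator T A B C \<iota> (output_adjoint T A B C \<iota> \<psi>)"

end

theory Submission
  imports Defs
begin

text \<open>Exact output tracking controllability is surjectivity of \<open>\<Lambda> = output_operator T A B C \<iota>\<close> by
  definition. The remaining equivalences hold for every bounded linear operator \<open>\<Lambda>\<close> from L2 to a Hilbert
  space \<open>Y\<close>. Write \<open>\<Lambda>*\<close> for its adjoint and \<open>G = \<Lambda> \<Lambda>*\<close> for its Gramian, so that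
  \<open>\<psi> (G \<psi>) = \<parallel>\<Lambda>* \<psi>\<parallel>\<^sup>2\<close> for every functional \<open>\<psi>\<close> on \<open>Y\<close>.

  If \<open>\<Lambda>\<close> is surjective, then every point of \<open>Y\<close> is \<open>\<Lambda> u\<close> for some \<open>u\<close>, and
  \<open>\<psi> (\<Lambda> u) = \<langle>\<Lambda>* \<psi>, u\<rangle>\<close> shows that the functionals with \<open>\<parallel>\<Lambda>* \<psi>\<parallel> \<le> 1\<close> are pointwise bounded.
  The uniform boundedness principle turns this into the observability inequality
  \<open>\<parallel>\<psi>\<parallel> \<le> \<gamma> \<parallel>\<Lambda>* \<psi>\<parallel>\<close> (\<open>coercive_if_surjective\<close>).
  If the inequality holds, then \<open>\<phi> (G \<psi>)\<close> is an inner product on the dual of \<open>Y\<close> whose norm is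
  equivalent to the dual norm, and Riesz' theorem for it, applied to evaluation at a point \<open>y\<close>, solves
  \<open>G \<psi> = y\<close> (\<open>gram_surjective_if_coercive\<close>). The same inequality gives \<open>\<parallel>\<psi>\<parallel> \<le> \<gamma>\<^sup>2 \<parallel>G \<psi>\<parallel>\<close>, so
  that \<open>G\<close> is injective and its inverse is Lipschitz. Finally, if \<open>G = \<Lambda> \<Lambda>*\<close> is surjective, then so is
  \<open>\<Lambda>\<close>.

  Riesz' theorem is used twice: for L2, where it provides \<open>\<Lambda>*\<close>, and for the dual of \<open>Y\<close> with the Gramian
  form. It is therefore proved for an abstract complete semi-inner product (\<open>Riesz_representation\<close>), and
  L2 is shown to be an instance by the Riesz--Fischer theorem (\<open>L2_complete\<close>). What is specific to the
  control system is only that its output operator is linear on representatives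
  (\<open>output_operator_comb\<close>).\<close>

section \<open>Riesz' representation theorem for a complete semi-inner product\<close>

text \<open>A semi-inner product space, given by representatives. Neither square-integrable functions
  under pointwise operations nor the dual of an output space under the Gramian form are
  inner product spaces as types: the former is only a set of functions, with a degenerate form,
  and the latter has the wrong norm. Here \<open>comb u c v\<close> stands for \<open>u + c v\<close>; vectors are
  inspected only through the form, so its linearity along \<open>comb\<close> carries the whole vector space
  structure.\<close>

locale semi_inner_space =
  fixes V :: "'v set" and comb :: "'v \<Rightarrow> real \<Rightarrow> 'v \<Rightarrow> 'v" and form :: "'v \<Rightarrow> 'v \<Rightarrow> real"
  assumes nonempty: "V \<noteq> {}"
    and comb_closed: "u \<in> V \<Longrightarrow> v \<in> V \<Longrightarrow> comb u c v \<in> V"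
    and form_sym: "u \<in> V \<Longrightarrow> v \<in> V \<Longrightarrow> form u v = form v u"
    and form_comb: "u \<in> V \<Longrightarrow> v \<in> V \<Longrightarrow> w \<in> V \<Longrightarrow> form (comb u c v) w = form u w + c * form v w"
    and form_nonneg: "u \<in> V \<Longrightarrow> form u u \<ge> 0"
begin

definition sqdist :: "'v \<Rightarrow> 'v \<Rightarrow> real" where
  "sqdist u v = form (comb u (-1) v) (comb u (-1) v)"

lemma form_comb_right:
  assumes "u \<in> V" "v \<in> V" "w \<in> V"
  shows "form w (comb u c v) = form w u + c * form w v"
  using assms by (simp add: form_sym[of w] comb_closed form_comb)

lemma form_comb_self:
  assumes "u \<in> V" "v \<in> V"
  shows "form (comb u c v) (comb u c v) = form u u + 2 * c * form u v + c\<^sup>2 * form v v"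
  using assms
  by (simp add: form_comb form_comb_right comb_closed form_sym[of v u] power2_eq_square algebra_simps)

lemma Cauchy_Schwarz_form:
  assumes "u \<in> V" "v \<in> V"
  shows "(form u v)\<^sup>2 \<le> form u u * form v v"
proof -
  have q: "0 \<le> form u u + 2 * t * form u v + t\<^sup>2 * form v v" for t
    using form_nonneg[OF comb_closed[OF assms, of t]] form_comb_self[OF assms] by simp
  show ?thesis
  proof (cases "form v v = 0")
    case True
    have "form u v = 0"
    proof (rule ccontr)
      assume "form u v \<noteq> 0"
      then show False
        using q[of "- (form u u + 1) / (2 * form u v)"] True by (simp add: field_simps)
    qed
    then show ?thesis using True by simp
  next
    case False
    then have pos: "form v v > 0" using form_nonneg[OF assms(2)] by simp
    have "0 \<le> form u u - (form u v)\<^sup>2 / form v v"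
      using q[of "- form u v / form v v"] pos by (simp add: power2_eq_square field_simps)
    then show ?thesis using pos by (simp add: field_simps)
  qed
qed

lemma form_limit:
  assumes f: "\<And>n. f n \<in> V" and v: "v \<in> V" and w: "w \<in> V"
    and lim: "(\<lambda>n. sqdist (f n) v) \<longlonglongrightarrow> 0"
  shows "(\<lambda>n. form (f n) w) \<longlonglongrightarrow> form v w"
proof -
  have bound: "norm (form (f n) w - form v w) \<le> sqrt (sqdist (f n) v * form w w)" for n
  proof -
    have "(form (f n) w - form v w)\<^sup>2 = (form (comb (f n) (-1) v) w)\<^sup>2"
      by (simp add: form_comb f v w)
    also have "\<dots> \<le> sqdist (f n) v * form w w"
      unfolding sqdist_def by (intro Cauchy_Schwarz_form comb_closed f v w)
    finally show ?thesis by (simp add: real_le_rsqrt)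
  qed
  have "(\<lambda>n. sqrt (sqdist (f n) v * form w w)) \<longlonglongrightarrow> sqrt (0 * form w w)"
    by (intro tendsto_intros lim)
  then have "(\<lambda>n. sqrt (sqdist (f n) v * form w w)) \<longlonglongrightarrow> 0" by simp
  then have "(\<lambda>n. form (f n) w - form v w) \<longlonglongrightarrow> 0"
    by (rule Lim_null_comparison[OF always_eventually[OF allI[OF bound]]])
  then show ?thesis by (simp add: LIM_zero_iff)
qed

end

locale complete_semi_inner_space = semi_inner_space +
  assumes complete:
    "(\<And>n. f n \<in> V) \<Longrightarrow> (\<And>e. e > 0 \<Longrightarrow> \<exists>N. \<forall>m\<ge>N. \<forall>n\<ge>N. sqdist (f m) (f n) < e)
      \<Longrightarrow> \<exists>v\<in>V. (\<lambda>n. sqdist (f n) v) \<longlonglongrightarrow> 0"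
begin

text \<open>The representing vector minimises the energy \<open>J v = form v v - 2 F v\<close>, which is bounded below
  by \<open>- K\<^sup>2\<close>. By the parallelogram law a minimising sequence is Cauchy, so it has a limit \<open>v\<close>.
  That the first variation of \<open>J\<close> vanishes at a minimiser is the equation \<open>form v w = F w\<close>. It is
  obtained by passing to the limit in the variational inequality for the sequence, so that \<open>J\<close>
  itself need not be shown to be continuous.\<close>

theorem Riesz_representation:
  assumes F_comb: "\<And>u v c. u \<in> V \<Longrightarrow> v \<in> V \<Longrightarrow> F (comb u c v) = F u + c * F v"
    and F_bound: "\<And>v. v \<in> V \<Longrightarrow> \<bar>F v\<bar> \<le> K * sqrt (form v v)"
  shows "\<exists>v\<in>V. \<forall>w\<in>V. form v w = F w"
proof -
  define J where "J v = form v v - 2 * F v" for v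
  define m where "m = Inf (J ` V)"
  have J_comb: "J (comb u c v) = J u + 2 * c * (form u v - F v) + c\<^sup>2 * form v v"
    if "u \<in> V" "v \<in> V" for u v c
    using that by (simp add: J_def form_comb_self F_comb algebra_simps)
  have lower: "- K\<^sup>2 \<le> J v" if "v \<in> V" for v
  proof -
    have "2 * F v \<le> 2 * (K * sqrt (form v v))" using F_bound[OF that] by simp
    also have "\<dots> \<le> form v v + K\<^sup>2"
      using zero_le_power2[of "sqrt (form v v) - K"] form_nonneg[OF that]
      by (simp add: power2_diff algebra_simps)
    finally show ?thesis by (simp add: J_def)
  qed
  have bdd: "bdd_below (J ` V)" using lower by (rule bdd_belowI2)
  have m_le: "m \<le> J v" if "v \<in> V" for v
    unfolding m_def using bdd that by (simp add: cInf_lower)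
  define \<epsilon> where "\<epsilon> n = 1 / (real n + 1)" for n
  have \<epsilon>_antimono: "\<epsilon> n \<le> \<epsilon> N" if "N \<le> n" for n N
    using that by (auto simp: \<epsilon>_def intro!: divide_left_mono)
  have \<epsilon>_lim: "\<epsilon> \<longlonglongrightarrow> 0"
    using LIMSEQ_inverse_real_of_nat by (simp add: \<epsilon>_def[abs_def] inverse_eq_divide add.commute)
  have "\<exists>v\<in>V. J v < m + \<epsilon> n" for n
  proof -
    have "Inf (J ` V) < m + \<epsilon> n" by (simp add: m_def \<epsilon>_def add_pos_nonneg)
    then show ?thesis using cInf_lessD[of "J ` V" "m + \<epsilon> n"] nonempty by blast
  qed
  then obtain f where f: "\<And>n. f n \<in> V" and Jf: "\<And>n. J (f n) < m + \<epsilon> n"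
    by metis
  have close: "sqdist (f k) (f n) \<le> 2 * \<epsilon> k + 2 * \<epsilon> n" for k n
  proof -
    define d where "d = comb (f k) (-1) (f n)"
    have d: "d \<in> V" by (simp add: d_def comb_closed f)
    \<comment> \<open>compare with the midpoint of \<open>f k\<close> and \<open>f n\<close>\<close>
    have "m \<le> J (comb (f n) (1/2) d)" by (intro m_le comb_closed f d)
    also have "\<dots> = J (f n) + (form (f n) d - F d) + form d d / 4"
      using J_comb[OF f d, of n "1/2"] by (simp add: power2_eq_square)
    also have "J (f k) = J (f n) + 2 * (form (f n) d - F d) + form d d"
      unfolding J_def d_def
      by (simp add: form_comb form_comb_right comb_closed f F_comb form_sym[of "f k" "f n"])
    then have "form (f n) d - F d = (J (f k) - J (f n) - form d d) / 2" by simp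
    finally have "form d d \<le> 2 * (J (f k) - m) + 2 * (J (f n) - m)"
      by (simp add: field_simps)
    also have "\<dots> \<le> 2 * \<epsilon> k + 2 * \<epsilon> n"
      by (intro add_mono) (use Jf[of k] Jf[of n] in simp_all)
    finally show ?thesis by (simp add: sqdist_def d_def)
  qed
  have "\<exists>N. \<forall>k\<ge>N. \<forall>n\<ge>N. sqdist (f k) (f n) < e" if "e > 0" for e
  proof -
    obtain N where N: "\<epsilon> N < e / 4"
      using order_tendstoD(2)[OF \<epsilon>_lim, of "e / 4"] \<open>e > 0\<close>
      by (auto simp: eventually_sequentially)
    have "sqdist (f k) (f n) < e" if "k \<ge> N" "n \<ge> N" for k n
      using close[of k n] \<epsilon>_antimono[OF that(1)] \<epsilon>_antimono[OF that(2)] N by simp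
    then show ?thesis by blast
  qed
  from complete[OF f this] obtain v where v: "v \<in> V" and lim: "(\<lambda>n. sqdist (f n) v) \<longlonglongrightarrow> 0"
    by blast
  have "form v w = F w" if w: "w \<in> V" for w
  proof -
    define \<beta> where "\<beta> = form v w - F w"
    have min: "0 \<le> 2 * t * \<beta> + t\<^sup>2 * form w w" for t
    proof (rule LIMSEQ_le_const)
      show "(\<lambda>n. \<epsilon> n + 2 * t * (form (f n) w - F w) + t\<^sup>2 * form w w)
              \<longlonglongrightarrow> 2 * t * \<beta> + t\<^sup>2 * form w w"
        unfolding \<beta>_def
        using tendsto_add[OF tendsto_add[OF \<epsilon>_lim
            tendsto_mult_left[OF tendsto_diff[OF form_limit[OF f v w lim] tendsto_const]]]
            tendsto_const, of "2 * t" "F w" "t\<^sup>2 * form w w"]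
        by simp
      have "0 \<le> \<epsilon> n + 2 * t * (form (f n) w - F w) + t\<^sup>2 * form w w" for n
        using m_le[OF comb_closed[OF f[of n] w, of t]] J_comb[OF f[of n] w, of t] Jf[of n] by simp
      then show "\<exists>N. \<forall>n\<ge>N. 0 \<le> \<epsilon> n + 2 * t * (form (f n) w - F w) + t\<^sup>2 * form w w"
        by blast
    qed
    \<comment> \<open>the choice \<open>t = - \<beta> / a\<close> refutes \<open>\<beta> \<noteq> 0\<close>; the summand 1 keeps \<open>a\<close> positive for degenerate \<open>w\<close>\<close>
    define a where "a = form w w + 1"
    have a: "a > 0" using form_nonneg[OF w] by (simp add: a_def)
    have "0 \<le> a\<^sup>2 * (2 * (- \<beta> / a) * \<beta> + (- \<beta> / a)\<^sup>2 * form w w)"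
      using min[of "- \<beta> / a"] by (intro mult_nonneg_nonneg) auto
    also have "\<dots> = - (\<beta>\<^sup>2 * (a + 1))"
      using a by (simp add: a_def[symmetric] divide_simps) (simp add: a_def power2_eq_square algebra_simps)
    finally have "\<beta>\<^sup>2 * (a + 1) \<le> 0" by simp
    then have "\<beta>\<^sup>2 \<le> 0" using a by (simp add: mult_le_0_iff)
    then show ?thesis by (simp add: \<beta>_def)
  qed
  then show ?thesis using v by blast
qed

end

section \<open>The space of square-integrable functions\<close>

abbreviation fun_comb :: "('a \<Rightarrow> 'b::real_vector) \<Rightarrow> real \<Rightarrow> ('a \<Rightarrow> 'b) \<Rightarrow> 'a \<Rightarrow> 'b" where
  "fun_comb u c v \<equiv> (\<lambda>x. u x + c *\<^sub>R v x)"

lemma L2_space_inner_integrable: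
  assumes "u \<in> L2_space M" "v \<in> L2_space M"
  shows "integrable M (\<lambda>x. u x \<bullet> v x)"
proof (rule Bochner_Integration.integrable_bound)
  show "integrable M (\<lambda>x. (norm (u x))\<^sup>2 + (norm (v x))\<^sup>2)"
    using assms by (auto simp: L2_space_def)
  show "(\<lambda>x. u x \<bullet> v x) \<in> borel_measurable M"
    using assms by (auto simp: L2_space_def)
  have "\<bar>a \<bullet> b\<bar> \<le> (norm a)\<^sup>2 + (norm b)\<^sup>2" for a b :: 'b
  proof -
    have "\<bar>a \<bullet> b\<bar> \<le> norm a * norm b" by (rule Cauchy_Schwarz_ineq2)
    also have "\<dots> \<le> (norm a)\<^sup>2 + (norm b)\<^sup>2"
      using sum_squares_bound[of "norm a" "norm b"]
        mult_nonneg_nonneg[OF norm_ge_zero[of a] norm_ge_zero[of b]] by linarith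
    finally show ?thesis .
  qed
  then show "AE x in M. norm (u x \<bullet> v x) \<le> norm ((norm (u x))\<^sup>2 + (norm (v x))\<^sup>2)" by simp
qed

lemma L2_space_comb:
  assumes "u \<in> L2_space M" "v \<in> L2_space M"
  shows "fun_comb u c v \<in> L2_space M"
proof -
  have "(norm (u x + c *\<^sub>R v x))\<^sup>2 = (norm (u x))\<^sup>2 + 2 * c * (u x \<bullet> v x) + c\<^sup>2 * (norm (v x))\<^sup>2" for x
    unfolding power2_norm_eq_inner
    by (simp add: inner_add_left inner_add_right inner_commute power2_eq_square[of c] algebra_simps)
  moreover have "integrable M
      (\<lambda>x. (norm (u x))\<^sup>2 + 2 * c * (u x \<bullet> v x) + c\<^sup>2 * (norm (v x))\<^sup>2)"
    using assms L2_space_inner_integrable[OF assms]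
    by (auto simp: L2_space_def)
  moreover have "fun_comb u c v \<in> borel_measurable M"
    using assms by (auto simp: L2_space_def)
  ultimately show ?thesis by (simp add: L2_space_def)
qed

lemma L2_norm_eq: "L2_norm M u = sqrt (L2_inner M u u)"
  by (simp add: L2_norm_def L2_inner_def power2_norm_eq_inner)

interpretation L2: semi_inner_space
  "L2_space M :: ('a \<Rightarrow> 'b::euclidean_space) set" fun_comb "L2_inner M"
  for M :: "'a measure"
proof
  have "(\<lambda>_. 0) \<in> L2_space M" by (simp add: L2_space_def)
  then show "L2_space M \<noteq> ({} :: ('a \<Rightarrow> 'b) set)" by blast
next
  fix u v w :: "'a \<Rightarrow> 'b" and c
  assume uv: "u \<in> L2_space M" "v \<in> L2_space M"
  show "L2_inner M u v = L2_inner M v u" by (simp add: L2_inner_def inner_commute)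
  assume w: "w \<in> L2_space M"
  show "L2_inner M (fun_comb u c v) w = L2_inner M u w + c * L2_inner M v w"
    using L2_space_inner_integrable[OF uv(1) w] L2_space_inner_integrable[OF uv(2) w]
    by (simp add: L2_inner_def inner_add_left)
qed (auto simp: L2_inner_def intro: L2_space_comb)

lemma L2_sqdist_eq: "L2.sqdist M u v = (\<integral>x. (norm (u x - v x))\<^sup>2 \<partial>M)"
  by (simp add: L2.sqdist_def L2_inner_def power2_norm_eq_inner)

lemma nn_integral_L2_sqdist:
  assumes "u \<in> L2_space M" "v \<in> L2_space M"
  shows "(\<integral>\<^sup>+x. ennreal ((norm (u x - v x))\<^sup>2) \<partial>M) = ennreal (L2.sqdist M u v)"
  using L2_space_comb[OF assms, of "-1"] unfolding L2_sqdist_eq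
  by (intro nn_integral_eq_integral) (auto simp: L2_space_def)

text \<open>The integrals of \<open>4 ^ k * (norm (g (k+1) - g k))\<^sup>2\<close> are dominated by a geometric series, hence
  the series of these functions converges almost everywhere. Its terms then tend to 0, which makes the
  increments eventually at most \<open>(1/2) ^ k\<close> in norm, so that the telescoping series converges absolutely.\<close>
lemma L2_rapidly_Cauchy_AE_convergent:
  fixes g :: "nat \<Rightarrow> 'a \<Rightarrow> 'b::euclidean_space"
  assumes g: "\<And>k. g k \<in> L2_space M"
    and rapid: "\<And>k. L2.sqdist M (g (Suc k)) (g k) \<le> (1/16) ^ k"
  shows "AE x in M. convergent (\<lambda>k. g k x)"
proof -
  define h where "h k x = 4 ^ k * (norm (g (Suc k) x - g k x))\<^sup>2" for k x
  have gm[measurable]: "g k \<in> borel_measurable M" for k using g by (simp add: L2_space_def)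
  have hm[measurable]: "h k \<in> borel_measurable M" for k unfolding h_def[abs_def] by measurable
  have "(\<integral>\<^sup>+x. ennreal (h k x) \<partial>M) \<le> ennreal ((1/4) ^ k)" for k
  proof -
    have "(\<integral>\<^sup>+x. ennreal (h k x) \<partial>M) = ennreal (4 ^ k) * ennreal (L2.sqdist M (g (Suc k)) (g k))"
      by (simp add: h_def ennreal_mult nn_integral_cmult nn_integral_L2_sqdist[OF g g, symmetric])
    also have "\<dots> \<le> ennreal (4 ^ k) * ennreal ((1/16) ^ k)"
      by (intro mult_left_mono ennreal_leI rapid) simp
    also have "\<dots> = ennreal ((1/4) ^ k)"
      by (simp add: ennreal_mult[symmetric] power_mult_distrib[symmetric])
    finally show ?thesis .
  qed
  then have "(\<Sum>k. \<integral>\<^sup>+x. ennreal (h k x) \<partial>M) \<le> (\<Sum>k. ennreal ((1/4) ^ k))"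
    by (intro suminf_le) auto
  also have "\<dots> = ennreal (\<Sum>k. (1/4) ^ k)"
    by (intro suminf_ennreal2) (auto intro: summable_geometric)
  finally have "(\<integral>\<^sup>+x. (\<Sum>k. ennreal (h k x)) \<partial>M) \<noteq> \<infinity>"
    by (auto simp: nn_integral_suminf top_unique)
  then have "AE x in M. (\<Sum>k. ennreal (h k x)) \<noteq> \<infinity>"
    by (intro nn_integral_PInf_AE) measurable
  then show ?thesis
  proof eventually_elim
    case (elim x)
    then have "summable (\<lambda>k. h k x)"
      by (intro summable_suminf_not_top) (auto simp: h_def)
    then have "(\<lambda>k. h k x) \<longlonglongrightarrow> 0" by (rule summable_LIMSEQ_zero)
    then have "eventually (\<lambda>k. h k x < 1) sequentially" by (rule order_tendstoD) simp
    then have "eventually (\<lambda>k. norm (g (Suc k) x - g k x) \<le> (1/2) ^ k) sequentially"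
    proof eventually_elim
      case (elim k)
      have "((2::real) ^ k)\<^sup>2 = 4 ^ k"
        by (simp add: power2_eq_square flip: power_mult_distrib)
      then have "(norm (g (Suc k) x - g k x) * 2 ^ k)\<^sup>2 \<le> 1\<^sup>2"
        using elim by (simp add: h_def power_mult_distrib mult.commute)
      then have "norm (g (Suc k) x - g k x) * 2 ^ k \<le> 1" by (rule power2_le_imp_le) simp
      then show ?case by (simp add: power_divide field_simps)
    qed
    then have "summable (\<lambda>k. g (Suc k) x - g k x)"
      by (rule summable_comparison_test_ev) (simp add: summable_geometric)
    then have "convergent (\<lambda>n. \<Sum>k<n. g (Suc k) x - g k x)"
      by (simp add: summable_iff_convergent)
    then have "convergent (\<lambda>n. g n x - g 0 x)"
      by (simp only: sum_lessThan_telescope[of "\<lambda>k. g k x"])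
    then have "convergent (\<lambda>n. (g n x - g 0 x) + g 0 x)"
      by (intro convergent_add convergent_const)
    then show ?case by simp
  qed
qed

text \<open>Riesz--Fischer. The candidate limit is the pointwise limit of a rapidly Cauchy subsequence; Fatou's
  lemma along that subsequence turns the Cauchy estimate into an estimate of the distance to the
  limit, for the whole sequence.\<close>

theorem L2_complete:
  fixes f :: "nat \<Rightarrow> 'a \<Rightarrow> 'b::euclidean_space"
  assumes f: "\<And>n. f n \<in> L2_space M"
    and Cauchy: "\<And>e. e > 0 \<Longrightarrow> \<exists>N. \<forall>m\<ge>N. \<forall>n\<ge>N. L2.sqdist M (f m) (f n) < e"
  shows "\<exists>v\<in>L2_space M. (\<lambda>n. L2.sqdist M (f n) v) \<longlonglongrightarrow> 0"
proof -
  have "\<forall>k::nat. \<exists>N. \<forall>m\<ge>N. \<forall>n\<ge>N. L2.sqdist M (f m) (f n) < (1/16) ^ k"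
    by (intro allI Cauchy) simp
  from choice[OF this] obtain N
    where N: "\<And>k m n. m \<ge> N k \<Longrightarrow> n \<ge> N k \<Longrightarrow> L2.sqdist M (f m) (f n) < (1/16) ^ k"
    by blast
  \<comment> \<open>partial sums dominate all earlier thresholds, so that \<open>r k\<close> lies beyond \<open>N j\<close> for every \<open>j \<le> k\<close>\<close>
  define r where "r k = (\<Sum>i\<le>k. N i)" for k
  have r: "r k \<ge> N j" if "j \<le> k" for j k
    unfolding r_def using that by (intro member_le_sum) auto
  define v where "v x = lim (\<lambda>k. f (r k) x)" for x
  have fm[measurable]: "f n \<in> borel_measurable M" for n using f by (simp add: L2_space_def)
  have vm[measurable]: "v \<in> borel_measurable M" unfolding v_def[abs_def] by measurable
  have "AE x in M. convergent (\<lambda>k. f (r k) x)"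
    using N r by (intro L2_rapidly_Cauchy_AE_convergent f less_imp_le) auto
  then have lim: "AE x in M. (\<lambda>k. f (r k) x) \<longlonglongrightarrow> v x"
    by eventually_elim (simp add: v_def convergent_LIMSEQ_iff)
  have fatou: "(\<integral>\<^sup>+x. ennreal ((norm (v x - f n x))\<^sup>2) \<partial>M) \<le> ennreal ((1/16) ^ j)"
    if n: "n \<ge> N j" for n j
  proof -
    have "(\<integral>\<^sup>+x. ennreal ((norm (v x - f n x))\<^sup>2) \<partial>M)
        = (\<integral>\<^sup>+x. liminf (\<lambda>k. ennreal ((norm (f (r k) x - f n x))\<^sup>2)) \<partial>M)"
    proof (rule nn_integral_cong_AE)
      show "AE x in M. ennreal ((norm (v x - f n x))\<^sup>2)
          = liminf (\<lambda>k. ennreal ((norm (f (r k) x - f n x))\<^sup>2))"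
        using lim
      proof eventually_elim
        case (elim x)
        then have "(\<lambda>k. ennreal ((norm (f (r k) x - f n x))\<^sup>2)) \<longlonglongrightarrow> ennreal ((norm (v x - f n x))\<^sup>2)"
          by (intro tendsto_intros)
        then show ?case by (rule lim_imp_Liminf[OF sequentially_bot, symmetric])
      qed
    qed
    also have "\<dots> \<le> liminf (\<lambda>k. \<integral>\<^sup>+x. ennreal ((norm (f (r k) x - f n x))\<^sup>2) \<partial>M)"
      by (intro nn_integral_liminf) measurable
    also have "\<dots> \<le> limsup (\<lambda>k. \<integral>\<^sup>+x. ennreal ((norm (f (r k) x - f n x))\<^sup>2) \<partial>M)"
      by (intro Liminf_le_Limsup) simp
    also have "\<dots> \<le> ennreal ((1/16) ^ j)"
    proof (rule Limsup_bounded)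
      show "eventually (\<lambda>k. (\<integral>\<^sup>+x. ennreal ((norm (f (r k) x - f n x))\<^sup>2) \<partial>M)
          \<le> ennreal ((1/16) ^ j)) sequentially"
        using eventually_ge_at_top[of j]
      proof eventually_elim
        case (elim k)
        then show ?case
          unfolding nn_integral_L2_sqdist[OF f f]
          using N[OF r n] by (intro ennreal_leI less_imp_le) auto
      qed
    qed
    finally show ?thesis .
  qed
  have diff: "(\<lambda>x. v x - f n x) \<in> L2_space M" if "n \<ge> N 0" for n
  proof -
    have "integrable M (\<lambda>x. (norm (v x - f n x))\<^sup>2)"
      using fatou[OF that] by (intro integrableI_bounded) (auto simp: le_less_trans)
    then show ?thesis by (simp add: L2_space_def)
  qed
  have "(\<lambda>x. f (N 0) x + 1 *\<^sub>R (v x - f (N 0) x)) \<in> L2_space M"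
    by (intro L2_space_comb f diff) simp
  then have v: "v \<in> L2_space M" by simp
  have "(\<lambda>n. L2.sqdist M (f n) v) \<longlonglongrightarrow> 0"
  proof (rule LIMSEQ_I)
    fix e :: real
    assume "e > 0"
    then obtain j where j: "(1/16) ^ j < e" using real_arch_pow_inv[of e "1/16"] by auto
    have "norm (L2.sqdist M (f n) v - 0) < e" if "n \<ge> N j" for n
    proof -
      have "L2.sqdist M v (f n) \<le> (1/16) ^ j"
        using fatou[OF that] unfolding nn_integral_L2_sqdist[OF v f] by simp
      then show ?thesis
        using j by (simp add: L2_sqdist_eq norm_minus_commute)
    qed
    then show "\<exists>n0. \<forall>n\<ge>n0. norm (L2.sqdist M (f n) v - 0) < e" by blast
  qed
  then show ?thesis using v by blast
qed

interpretation L2: complete_semi_inner_space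
  "L2_space M :: ('a \<Rightarrow> 'b::euclidean_space) set" fun_comb "L2_inner M"
  for M :: "'a measure"
  by unfold_locales (rule L2_complete)

section \<open>The uniform boundedness principle\<close>

text \<open>Banach--Steinhaus. The space is the union of the closed sets \<open>E n\<close> on which all operators are bounded
  by \<open>n\<close>; by Baire's theorem one of them contains a ball, and differences of points of that ball cover a
  ball around 0.\<close>

theorem uniform_boundedness:
  fixes \<Phi> :: "('a::{real_normed_vector, complete_space} \<Rightarrow>\<^sub>L 'b::real_normed_vector) set"
  assumes pointwise: "\<And>x. \<exists>c. \<forall>\<psi>\<in>\<Phi>. norm (blinfun_apply \<psi> x) \<le> c"
  shows "\<exists>\<gamma>>0. \<forall>\<psi>\<in>\<Phi>. norm \<psi> \<le> \<gamma>"
proof -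
  define E where "E n = {x. \<forall>\<psi>\<in>\<Phi>. norm (blinfun_apply \<psi> x) \<le> real n}" for n
  have closed: "closed (E n)" for n
  proof -
    have "E n = (\<Inter>\<psi>\<in>\<Phi>. {x. norm (blinfun_apply \<psi> x) \<le> real n})" by (auto simp: E_def)
    then show ?thesis by (auto intro!: closed_INT closed_Collect_le continuous_intros)
  qed
  have cover: "(\<Union>n. E n) = UNIV"
  proof -
    have "\<exists>n. x \<in> E n" for x
    proof -
      obtain c where "\<forall>\<psi>\<in>\<Phi>. norm (blinfun_apply \<psi> x) \<le> c" using pointwise by blast
      moreover obtain n where "c \<le> real n" using real_arch_simple by blast
      ultimately have "x \<in> E n" unfolding E_def by (auto intro: order_trans)
      then show ?thesis by blast
    qed
    then show ?thesis by blast
  qed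
  have "\<exists>n. interior (E n) \<noteq> {}"
  proof (rule ccontr)
    assume "\<not> ?thesis"
    then have "euclidean interior_of (\<Union> (range E)) = {}"
      using closed by (intro Baire_category_alt) (auto simp: completely_metrizable_space_euclidean)
    then show False using cover by simp
  qed
  then obtain n x0 where "x0 \<in> interior (E n)" by blast
  then obtain r where r: "r > 0" "ball x0 r \<subseteq> E n"
    by (meson mem_interior)
  define \<gamma> where "\<gamma> = 4 * real n / r"
  have "norm \<psi> \<le> \<gamma>" if \<psi>: "\<psi> \<in> \<Phi>" for \<psi>
  proof (rule norm_blinfun_bound)
    show "0 \<le> \<gamma>" using r by (simp add: \<gamma>_def)
    fix x
    show "norm (blinfun_apply \<psi> x) \<le> \<gamma> * norm x"
    proof (cases "x = 0")
      case False
      \<comment> \<open>\<open>x\<close> rescaled to half the radius, so that \<open>x0 + z\<close> stays in the ball\<close>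
      define z where "z = (r / (2 * norm x)) *\<^sub>R x"
      have "norm z < r" using False r by (simp add: z_def)
      then have "x0 + z \<in> E n" "x0 \<in> E n" using r by (auto simp: dist_norm)
      then have "norm (blinfun_apply \<psi> (x0 + z)) \<le> real n" "norm (blinfun_apply \<psi> x0) \<le> real n"
        using \<psi> by (auto simp: E_def)
      then have "norm (blinfun_apply \<psi> z) \<le> 2 * real n"
        using norm_triangle_ineq4[of "blinfun_apply \<psi> (x0 + z)" "blinfun_apply \<psi> x0"]
        by (simp add: blinfun.add_right)
      then show ?thesis
        using False r by (simp add: z_def blinfun.scaleR_right \<gamma>_def field_simps)
    qed simp
  qed
  then have "\<forall>\<psi>\<in>\<Phi>. norm \<psi> \<le> \<gamma> + 1" by force
  moreover have "\<gamma> + 1 > 0" using r by (simp add: \<gamma>_def add_nonneg_pos)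
  ultimately show ?thesis by blast
qed

section \<open>Surjectivity, coercivity and the Gramian\<close>

lemma eq_if_functionals_agree:
  fixes y z :: "'y::real_inner"
  assumes "\<And>\<phi> :: 'y \<Rightarrow>\<^sub>L real. blinfun_apply \<phi> y = blinfun_apply \<phi> z"
  shows "y = z"
proof -
  have "y \<bullet> (y - z) = z \<bullet> (y - z)" using assms[of "blinfun_inner_left (y - z)"] by simp
  then have "(y - z) \<bullet> (y - z) = 0" by (simp only: inner_diff_left[of y z "y - z"])
  then show ?thesis by simp
qed

text \<open>An operator on representatives of L2 elements that is linear and bounded. It follows that it
  depends only on the class of its argument.\<close>

locale L2_operator =
  fixes M :: "'a measure"
    and \<Lambda> :: "('a \<Rightarrow> 'b::euclidean_space) \<Rightarrow> 'y::{real_inner, complete_space}"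
    and K :: real
  assumes op_comb: "u \<in> L2_space M \<Longrightarrow> v \<in> L2_space M \<Longrightarrow> \<Lambda> (fun_comb u c v) = \<Lambda> u + c *\<^sub>R \<Lambda> v"
    and op_bound: "u \<in> L2_space M \<Longrightarrow> norm (\<Lambda> u) \<le> K * L2_norm M u"
    and K_pos: "K > 0"
begin

abbreviation adj :: "('y \<Rightarrow>\<^sub>L real) \<Rightarrow> 'a \<Rightarrow> 'b" where
  "adj \<equiv> L2_adjoint M \<Lambda>"

definition gram :: "('y \<Rightarrow>\<^sub>L real) \<Rightarrow> 'y" where
  "gram \<psi> = \<Lambda> (adj \<psi>)"

lemma L2_norm_nonneg: "L2_norm M u \<ge> 0"
  by (simp add: L2_norm_def)

text \<open>The adjoint is defined by a choice; Riesz' theorem in L2 makes the choice meaningful.\<close>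

lemma adj: "adj \<psi> \<in> L2_space M"
  and inner_adj: "u \<in> L2_space M \<Longrightarrow> L2_inner M (adj \<psi>) u = blinfun_apply \<psi> (\<Lambda> u)"
proof -
  have "\<exists>v\<in>L2_space M. \<forall>u\<in>L2_space M. L2_inner M v u = blinfun_apply \<psi> (\<Lambda> u)"
  proof (rule L2.Riesz_representation)
    fix u v :: "'a \<Rightarrow> 'b" and c
    assume u: "u \<in> L2_space M"
    have "\<bar>blinfun_apply \<psi> (\<Lambda> u)\<bar> \<le> norm \<psi> * norm (\<Lambda> u)"
      using norm_blinfun[of \<psi> "\<Lambda> u"] by simp
    also have "\<dots> \<le> norm \<psi> * (K * L2_norm M u)"
      by (intro mult_left_mono op_bound u) simp
    finally show "\<bar>blinfun_apply \<psi> (\<Lambda> u)\<bar> \<le> (norm \<psi> * K) * sqrt (L2_inner M u u)"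
      by (simp add: L2_norm_eq mult.assoc)
    assume "v \<in> L2_space M"
    then show "blinfun_apply \<psi> (\<Lambda> (fun_comb u c v))
        = blinfun_apply \<psi> (\<Lambda> u) + c * blinfun_apply \<psi> (\<Lambda> v)"
      using u by (simp add: op_comb blinfun.add_right blinfun.scaleR_right)
  qed
  then have "adj \<psi> \<in> L2_space M
      \<and> (\<forall>u\<in>L2_space M. L2_inner M (adj \<psi>) u = blinfun_apply \<psi> (\<Lambda> u))"
    unfolding L2_adjoint_def Bex_def by (rule someI_ex)
  then show "adj \<psi> \<in> L2_space M"
    and "u \<in> L2_space M \<Longrightarrow> L2_inner M (adj \<psi>) u = blinfun_apply \<psi> (\<Lambda> u)"
    by blast+
qed

lemma apply_gram: "blinfun_apply \<phi> (gram \<psi>) = L2_inner M (adj \<phi>) (adj \<psi>)"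
  by (simp add: gram_def inner_adj adj)

lemma gram_sym: "blinfun_apply \<phi> (gram \<psi>) = blinfun_apply \<psi> (gram \<phi>)"
  by (simp add: apply_gram L2.form_sym adj)

lemma apply_gram_self: "blinfun_apply \<psi> (gram \<psi>) = (L2_norm M (adj \<psi>))\<^sup>2"
  by (simp add: apply_gram L2_norm_eq L2.form_nonneg adj)

text \<open>The adjoint itself is linear only modulo equality almost everywhere. The Gramian takes values in a
  genuine vector space, and there its symmetry moves the argument into the functional, where linearity is
  evident.\<close>

lemma linear_gram: "linear gram"
proof (rule linearI)
  fix \<psi> \<phi> and c :: real
  show "gram (\<psi> + \<phi>) = gram \<psi> + gram \<phi>"
    by (rule eq_if_functionals_agree)
       (simp add: blinfun.add_right gram_sym[of _ "\<psi> + \<phi>"] gram_sym[of _ \<psi>] gram_sym[of _ \<phi>]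
          blinfun.add_left)
  show "gram (c *\<^sub>R \<psi>) = c *\<^sub>R gram \<psi>"
    by (rule eq_if_functionals_agree)
       (simp add: blinfun.scaleR_right gram_sym[of _ "c *\<^sub>R \<psi>"] gram_sym[of _ \<psi>] blinfun.scaleR_left)
qed

lemma norm_adj_scale: "L2_norm M (adj (c *\<^sub>R \<psi>)) = \<bar>c\<bar> * L2_norm M (adj \<psi>)"
proof (rule power2_eq_imp_eq)
  show "(L2_norm M (adj (c *\<^sub>R \<psi>)))\<^sup>2 = (\<bar>c\<bar> * L2_norm M (adj \<psi>))\<^sup>2"
    by (simp add: apply_gram_self[symmetric] linear_scale[OF linear_gram] blinfun.scaleR_left
        blinfun.scaleR_right power_mult_distrib) (simp add: power2_eq_square)
qed (simp_all add: L2_norm_nonneg)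

lemma norm_adj_le: "L2_norm M (adj \<psi>) \<le> K * norm \<psi>"
proof (cases "L2_norm M (adj \<psi>) = 0")
  case True
  then show ?thesis using K_pos by simp
next
  case False
  then have pos: "L2_norm M (adj \<psi>) > 0" using L2_norm_nonneg[of "adj \<psi>"] by linarith
  have "(L2_norm M (adj \<psi>))\<^sup>2 = blinfun_apply \<psi> (gram \<psi>)" by (simp add: apply_gram_self)
  also have "\<dots> \<le> norm \<psi> * norm (gram \<psi>)" using norm_blinfun[of \<psi> "gram \<psi>"] by simp
  also have "\<dots> \<le> norm \<psi> * (K * L2_norm M (adj \<psi>))"
    unfolding gram_def by (intro mult_left_mono op_bound adj) simp
  finally show ?thesis using pos by (simp add: power2_eq_square mult_ac)
qed

text \<open>If \<open>y = \<Lambda> u\<close>, then \<open>\<psi> y\<close> is the inner product of \<open>adj \<psi>\<close> with \<open>u\<close>. So the functionals whose adjoint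
  image lies in the unit ball are bounded at every point, and hence uniformly bounded. Scaling gives the
  estimate for all functionals.\<close>

lemma coercive_if_surjective:
  assumes surj: "\<Lambda> ` L2_space M = UNIV"
  shows "\<exists>\<gamma>>0. \<forall>\<psi>. norm \<psi> \<le> \<gamma> * L2_norm M (adj \<psi>)"
proof -
  have "\<exists>\<gamma>>0. \<forall>\<psi>\<in>{\<psi>. L2_norm M (adj \<psi>) \<le> 1}. norm \<psi> \<le> \<gamma>"
  proof (rule uniform_boundedness)
    fix y
    obtain u where u: "u \<in> L2_space M" "y = \<Lambda> u" using surj by blast
    have "norm (blinfun_apply \<psi> y) \<le> sqrt (L2_inner M u u)" if \<psi>: "L2_norm M (adj \<psi>) \<le> 1" for \<psi>
    proof -
      have "(blinfun_apply \<psi> y)\<^sup>2 \<le> L2_inner M (adj \<psi>) (adj \<psi>) * L2_inner M u u"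
        using L2.Cauchy_Schwarz_form[OF adj u(1)] by (simp add: inner_adj u)
      also have "\<dots> \<le> 1 * L2_inner M u u"
        using \<psi> by (intro mult_right_mono L2.form_nonneg u) (simp add: L2_norm_eq)
      finally show ?thesis by (simp add: real_le_rsqrt)
    qed
    then show "\<exists>c. \<forall>\<psi>\<in>{\<psi>. L2_norm M (adj \<psi>) \<le> 1}. norm (blinfun_apply \<psi> y) \<le> c" by blast
  qed
  then obtain \<gamma> where \<gamma>: "\<gamma> > 0" "\<And>\<psi>. L2_norm M (adj \<psi>) \<le> 1 \<Longrightarrow> norm \<psi> \<le> \<gamma>" by blast
  have "norm \<psi> \<le> \<gamma> * L2_norm M (adj \<psi>)" for \<psi>
  proof (rule field_le_epsilon)
    fix e :: real
    assume e: "e > 0"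
    \<comment> \<open>scaling by a number strictly above \<open>L2_norm M (adj \<psi>)\<close> covers the case that this norm is 0\<close>
    define t where "t = L2_norm M (adj \<psi>) + e / \<gamma>"
    have t: "t > 0" "L2_norm M (adj \<psi>) \<le> t"
      using e \<gamma>(1) L2_norm_nonneg[of "adj \<psi>"] by (auto simp: t_def add_nonneg_pos)
    then have "norm ((1 / t) *\<^sub>R \<psi>) \<le> \<gamma>"
      by (intro \<gamma>(2)) (simp only: norm_adj_scale, simp)
    then have "norm \<psi> \<le> \<gamma> * t" using t by (simp add: field_simps)
    also have "\<dots> = \<gamma> * L2_norm M (adj \<psi>) + e" using \<gamma>(1) by (simp add: t_def field_simps)
    finally show "norm \<psi> \<le> \<gamma> * L2_norm M (adj \<psi>) + e" .
  qed
  then show ?thesis using \<gamma>(1) by blast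
qed

text \<open>Coercivity makes the Gramian form \<open>\<phi> (gram \<psi>)\<close> an inner product on the dual space whose norm
  \<open>L2_norm M (adj \<psi>)\<close> is equivalent to the dual norm; since the dual is a Banach space, the form is
  complete. Evaluation at \<open>y\<close> is a bounded functional of \<open>\<psi>\<close>, and the vector that represents it
  with respect to this form is a preimage of \<open>y\<close>. This is the Hilbert uniqueness method.\<close>

lemma gram_surjective_if_coercive:
  assumes coercive: "\<And>\<psi>. norm \<psi> \<le> \<gamma> * L2_norm M (adj \<psi>)" and "\<gamma> > 0"
  shows "surj gram"
proof -
  interpret dual: semi_inner_space UNIV "\<lambda>\<psi> c \<phi>. \<psi> + c *\<^sub>R \<phi>" "\<lambda>\<psi> \<phi>. blinfun_apply \<phi> (gram \<psi>)"
    by unfold_locales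
       (auto simp: gram_sym[symmetric] linear_add[OF linear_gram] linear_scale[OF linear_gram]
          blinfun.add_right blinfun.scaleR_right apply_gram_self intro: gram_sym)
  have sqdist: "dual.sqdist \<psi> \<phi> = (L2_norm M (adj (\<psi> - \<phi>)))\<^sup>2" for \<psi> \<phi>
    by (simp add: dual.sqdist_def apply_gram_self)
  interpret dual: complete_semi_inner_space UNIV "\<lambda>\<psi> c \<phi>. \<psi> + c *\<^sub>R \<phi>"
    "\<lambda>\<psi> \<phi>. blinfun_apply \<phi> (gram \<psi>)"
  proof
    fix f :: "nat \<Rightarrow> 'y \<Rightarrow>\<^sub>L real"
    assume Cauchy: "\<And>e. e > 0 \<Longrightarrow> \<exists>N. \<forall>m\<ge>N. \<forall>n\<ge>N. dual.sqdist (f m) (f n) < e"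
    have "Cauchy f"
    proof (rule CauchyI)
      fix e :: real
      assume e: "e > 0"
      then have "(e / \<gamma>)\<^sup>2 > 0" using \<open>\<gamma> > 0\<close> by simp
      from Cauchy[OF this] obtain N
        where N: "\<And>m n. m \<ge> N \<Longrightarrow> n \<ge> N \<Longrightarrow> (L2_norm M (adj (f m - f n)))\<^sup>2 < (e / \<gamma>)\<^sup>2"
        unfolding sqdist by blast
      have "norm (f m - f n) < e" if "m \<ge> N" "n \<ge> N" for m n
      proof -
        have "L2_norm M (adj (f m - f n)) < e / \<gamma>"
          using N[OF that] e \<open>\<gamma> > 0\<close> by (intro power2_less_imp_less[OF N[OF that]]) simp
        then show ?thesis
          using coercive[of "f m - f n"] \<open>\<gamma> > 0\<close> by (simp add: field_simps)
      qed
      then show "\<exists>N. \<forall>m\<ge>N. \<forall>n\<ge>N. norm (f m - f n) < e" by blast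
    qed
    then obtain \<psi> where "f \<longlonglongrightarrow> \<psi>" using Cauchy_convergent convergent_def by blast
    then have "(\<lambda>n. (K * norm (f n - \<psi>))\<^sup>2) \<longlonglongrightarrow> (K * norm (\<psi> - \<psi>))\<^sup>2"
      by (intro tendsto_intros)
    then have lim: "(\<lambda>n. (K * norm (f n - \<psi>))\<^sup>2) \<longlonglongrightarrow> 0" by simp
    have bound: "norm (dual.sqdist (f n) \<psi>) \<le> (K * norm (f n - \<psi>))\<^sup>2" for n
      unfolding sqdist using norm_adj_le[of "f n - \<psi>"]
      by (simp add: power_mono L2_norm_nonneg)
    have "(\<lambda>n. dual.sqdist (f n) \<psi>) \<longlonglongrightarrow> 0"
      by (rule Lim_null_comparison[OF always_eventually[OF allI[OF bound]] lim])
    then show "\<exists>\<psi>\<in>UNIV. (\<lambda>n. dual.sqdist (f n) \<psi>) \<longlonglongrightarrow> 0" by blast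
  qed
  have "\<exists>\<psi>. gram \<psi> = y" for y
  proof -
    have "\<exists>\<psi>\<in>UNIV. \<forall>(\<phi> :: 'y \<Rightarrow>\<^sub>L real)\<in>UNIV. blinfun_apply \<phi> (gram \<psi>) = blinfun_apply \<phi> y"
    proof (rule dual.Riesz_representation[where F = "\<lambda>\<phi>. blinfun_apply \<phi> y"])
      fix \<psi> \<phi> :: "'y \<Rightarrow>\<^sub>L real" and c
      show "blinfun_apply (\<psi> + c *\<^sub>R \<phi>) y = blinfun_apply \<psi> y + c * blinfun_apply \<phi> y"
        by (simp add: blinfun.add_left blinfun.scaleR_left)
      have "\<bar>blinfun_apply \<psi> y\<bar> \<le> norm \<psi> * norm y" using norm_blinfun[of \<psi> y] by simp
      also have "\<dots> \<le> (\<gamma> * L2_norm M (adj \<psi>)) * norm y"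
        by (intro mult_right_mono coercive) simp
      finally show "\<bar>blinfun_apply \<psi> y\<bar> \<le> (\<gamma> * norm y) * sqrt (blinfun_apply \<psi> (gram \<psi>))"
        by (simp add: apply_gram_self L2_norm_nonneg mult_ac)
    qed
    then show ?thesis using eq_if_functionals_agree by blast
  qed
  then show ?thesis by (metis surj_def)
qed

text \<open>Cancel one factor \<open>norm \<psi>\<close> in
  \<open>(norm \<psi>)\<^sup>2 \<le> \<gamma>\<^sup>2 * \<psi> (gram \<psi>) \<le> \<gamma>\<^sup>2 * norm \<psi> * norm (gram \<psi>)\<close>.\<close>

lemma norm_le_norm_gram:
  assumes coercive: "\<And>\<psi>. norm \<psi> \<le> \<gamma> * L2_norm M (adj \<psi>)"
  shows "norm \<psi> \<le> \<gamma>\<^sup>2 * norm (gram \<psi>)"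
proof (cases "\<psi> = 0")
  case False
  have "(norm \<psi>)\<^sup>2 \<le> (\<gamma> * L2_norm M (adj \<psi>))\<^sup>2" by (intro power_mono coercive) simp
  also have "\<dots> = \<gamma>\<^sup>2 * blinfun_apply \<psi> (gram \<psi>)" by (simp add: apply_gram_self power_mult_distrib)
  also have "\<dots> \<le> \<gamma>\<^sup>2 * (norm \<psi> * norm (gram \<psi>))"
    using norm_blinfun[of \<psi> "gram \<psi>"] by (intro mult_left_mono) auto
  finally have "norm \<psi> * norm \<psi> \<le> norm \<psi> * (\<gamma>\<^sup>2 * norm (gram \<psi>))"
    by (simp add: power2_eq_square mult_ac)
  then show ?thesis using False by simp
qed simp

lemma gram_isomorphism_if_coercive:
  assumes coercive: "\<And>\<psi>. norm \<psi> \<le> \<gamma> * L2_norm M (adj \<psi>)" and "\<gamma> > 0"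
  shows "bij gram" "continuous_on UNIV (inv gram)"
proof -
  have dist: "dist \<psi> \<phi> \<le> \<gamma>\<^sup>2 * dist (gram \<psi>) (gram \<phi>)" for \<psi> \<phi>
    using norm_le_norm_gram[OF coercive, of "\<psi> - \<phi>"]
    by (simp add: dist_norm linear_diff[OF linear_gram])
  have surj: "surj gram" by (rule gram_surjective_if_coercive[OF assms])
  moreover have "inj gram"
  proof (rule injI)
    fix \<psi> \<phi>
    assume "gram \<psi> = gram \<phi>"
    then show "\<psi> = \<phi>" using dist[of \<psi> \<phi>] by simp
  qed
  ultimately show "bij gram" by (simp add: bij_def)
  have "(\<gamma>\<^sup>2)-lipschitz_on UNIV (inv gram)"
  proof (rule lipschitz_onI)
    fix y z
    show "dist (inv gram y) (inv gram z) \<le> \<gamma>\<^sup>2 * dist y z"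
      using dist[of "inv gram y" "inv gram z"] by (simp add: surj_f_inv_f[OF surj])
  qed simp
  then show "continuous_on UNIV (inv gram)" by (rule lipschitz_on_continuous_on)
qed

text \<open>The Gramian factors through \<open>\<Lambda>\<close>.\<close>

lemma surjective_if_gram_surjective:
  assumes "surj gram"
  shows "\<Lambda> ` L2_space M = UNIV"
proof -
  have "range gram \<subseteq> \<Lambda> ` L2_space M"
    unfolding gram_def using adj by (intro image_subsetI imageI)
  then show ?thesis using assms by auto
qed

theorem surjective_iff_coercive:
  "\<Lambda> ` L2_space M = UNIV \<longleftrightarrow> (\<exists>\<gamma>>0. \<forall>\<psi>. norm \<psi> \<le> \<gamma> * L2_norm M (adj \<psi>))"
  using coercive_if_surjective surjective_if_gram_surjective gram_surjective_if_coercive by blast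

theorem coercive_iff_gram_isomorphism:
  "(\<exists>\<gamma>>0. \<forall>\<psi>. norm \<psi> \<le> \<gamma> * L2_norm M (adj \<psi>))
     \<longleftrightarrow> bij gram \<and> continuous_on UNIV (inv gram)"
  using gram_isomorphism_if_coercive coercive_if_surjective surjective_if_gram_surjective bij_is_surj
  by blast

end

section \<open>Linearity of the control-to-output operator\<close>

lemma bilinear_matrix_matrix_mult:
  "bilinear ((**) :: real^'n^'m \<Rightarrow> real^'p^'n \<Rightarrow> real^'p^'m)"
proof -
  have "(X + Y) ** Z = X ** Z + Y ** Z" for X Y :: "real^'n^'m" and Z :: "real^'p^'n"
    by (simp add: matrix_matrix_mult_def vec_eq_iff sum.distrib distrib_right)
  then show ?thesis
    unfolding bilinear_def
    by (auto intro!: linearI simp: matrix_add_ldistrib matrix_scalar_ac scalar_matrix_assoc)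
qed

lemma bilinear_matrix_vector_mult:
  "bilinear ((*v) :: real^'n^'m \<Rightarrow> real^'n \<Rightarrow> real^'m)"
  unfolding bilinear_def
  by (intro conjI allI linearI)
     (rule matrix_vector_right_distrib matrix_vector_mult_scaleR matrix_vector_mult_add_rdistrib
        scaleR_matrix_vector_assoc[symmetric])+

text \<open>Boundedness of matrix multiplication with constant \<open>K\<close> bounds the powers of \<open>A\<close> geometrically. On
  every ball a scalar exponential series therefore dominates the matrix exponential series, which
  converges uniformly there.\<close>

lemma continuous_on_matrix_exp: "continuous_on UNIV (matrix_exp :: real^'n^'n \<Rightarrow> _)"
proof -
  have "bounded_bilinear ((**) :: real^'n^'n \<Rightarrow> real^'n^'n \<Rightarrow> real^'n^'n)"
    using bilinear_matrix_matrix_mult by (simp only: bilinear_conv_bounded_bilinear)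
  then interpret mm: bounded_bilinear "(**) :: real^'n^'n \<Rightarrow> real^'n^'n \<Rightarrow> real^'n^'n" .
  obtain K where K_pos: "K > 0"
    and K: "\<forall>(X :: real^'n^'n) (Y :: real^'n^'n). norm (X ** Y) \<le> norm X * norm Y * K"
    using mm.pos_bounded by blast
  define P :: "nat \<Rightarrow> real^'n^'n \<Rightarrow> real^'n^'n" where
    "P k A = (((**) A ^^ k) (mat 1)) /\<^sub>R fact k" for k A
  have power_bound: "norm (((**) A ^^ k) (mat 1 :: real^'n^'n))
      \<le> (norm A * K) ^ k * norm (mat 1 :: real^'n^'n)"
    for A :: "real^'n^'n" and k
  proof (induction k)
    case (Suc k)
    have "norm (((**) A ^^ Suc k) (mat 1 :: real^'n^'n))
        \<le> norm A * norm (((**) A ^^ k) (mat 1 :: real^'n^'n)) * K"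
      using K by simp
    also have "\<dots> \<le> norm A * ((norm A * K) ^ k * norm (mat 1 :: real^'n^'n)) * K"
      using Suc K_pos by (intro mult_right_mono mult_left_mono) auto
    finally show ?case by (simp add: mult_ac)
  qed simp
  have cont_P: "continuous_on S (P k)" for S k
  proof -
    have "continuous_on S (\<lambda>A. ((**) A ^^ k) (mat 1 :: real^'n^'n))"
      by (induction k) (auto intro!: mm.continuous_on continuous_on_id continuous_on_const)
    then show ?thesis unfolding P_def[abs_def] by (intro continuous_intros)
  qed
  have "continuous_on (ball 0 R) (matrix_exp :: real^'n^'n \<Rightarrow> _)" for R :: real
  proof -
    define c where "c = norm (mat 1 :: real^'n^'n)"
    have "norm (P k A) \<le> (inverse (fact k) * (R * K) ^ k) * c" if "A \<in> ball 0 R" for A k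
    proof -
      have "norm (((**) A ^^ k) (mat 1 :: real^'n^'n)) \<le> (R * K) ^ k * c"
        using that K_pos unfolding c_def
        by (intro order_trans[OF power_bound] mult_right_mono power_mono) auto
      then show ?thesis
        by (simp add: P_def mult.assoc mult_left_mono)
    qed
    moreover have "summable (\<lambda>k. (inverse (fact k) * (R * K) ^ k) * c)"
      by (intro summable_mult2 summable_exp)
    ultimately have lim:
      "uniform_limit (ball 0 R) (\<lambda>n A. \<Sum>k<n. P k A) (\<lambda>A. \<Sum>k. P k A) sequentially"
      by (rule Weierstrass_m_test)
    have "continuous_on (ball 0 R) (\<lambda>A. \<Sum>k. P k A)"
      by (rule uniform_limit_theorem[OF always_eventually lim])
         (auto intro!: continuous_on_sum cont_P)
    then show ?thesis by (simp add: P_def matrix_exp_def[abs_def])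
  qed
  then have "isCont matrix_exp A" for A :: "real^'n^'n"
    by (rule continuous_on_interior[of "ball 0 (norm A + 1)"]) auto
  then show ?thesis by (simp add: continuous_on_eq_continuous_at)
qed

lemma L2_space_restrict_integrable:
  fixes u :: "real \<Rightarrow> 'b::euclidean_space"
  assumes u: "u \<in> L2_space (time_measure T)" and t: "t \<le> T"
  shows "u absolutely_integrable_on {0<..<t}"
proof -
  have "integrable (time_measure T) u"
  proof (rule Bochner_Integration.integrable_bound)
    have "integrable (time_measure T) (\<lambda>_. 1 :: real)"
      by (intro finite_measure.integrable_const finite_measure_lebesgue_on) simp
    then show "integrable (time_measure T) (\<lambda>s. 1 + (norm (u s))\<^sup>2)"
      using u by (auto simp: L2_space_def)
    show "u \<in> borel_measurable (time_measure T)" using u by (simp add: L2_space_def)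
    have "norm z \<le> 1 + (norm z)\<^sup>2" for z :: 'b
      using sum_squares_bound[of 1 "norm z"] norm_ge_zero[of z] unfolding power_one mult_1_right by linarith
    then show "AE s in time_measure T. norm (u s) \<le> norm (1 + (norm (u s))\<^sup>2)" by simp
  qed
  then have "u absolutely_integrable_on {0<..<T}"
    by (simp add: integrable_restrict_space set_integrable_def)
  then show ?thesis by (rule set_integrable_subset) (use t in auto)
qed

text \<open>The kernel is continuous on the compact interval, hence bounded, and a square-integrable input is
  integrable because the time interval has finite length. Integrability is what makes the convolution
  integral additive in the input.\<close>

lemma output_integrand_integrable:
  fixes A :: "real^'n^'n" and B :: "real^'m^'n" and C :: "real^'n^'p"
  assumes u: "u \<in> L2_space (time_measure T)" and t: "t \<le> T"
  shows "integrable (lebesgue_on {0<..<t})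
           (\<lambda>s. (C ** matrix_exp ((t - s) *\<^sub>R A) ** B) *v u s)"
proof -
  let ?k = "\<lambda>s. C ** matrix_exp ((t - s) *\<^sub>R A) ** B"
  have cont: "continuous_on S ?k" for S
  proof -
    have "continuous_on S (\<lambda>s. matrix_exp ((t - s) *\<^sub>R A))"
      by (rule continuous_on_compose2[OF continuous_on_matrix_exp]) (auto intro!: continuous_intros)
    then show ?thesis
      by (intro bilinear_continuous_on_compose[OF _ _ bilinear_matrix_matrix_mult] continuous_on_const)
  qed
  have "(\<lambda>s. ?k s *v u s) absolutely_integrable_on {0<..<t}"
  proof (rule absolutely_integrable_bounded_measurable_product[OF bilinear_matrix_vector_mult])
    show "?k \<in> borel_measurable (lebesgue_on {0<..<t})"
      by (intro continuous_imp_measurable_on_sets_lebesgue cont) simp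
    have "bounded (?k ` {0..t})"
      by (intro compact_imp_bounded compact_continuous_image cont) simp
    then show "bounded (?k ` {0<..<t})"
      by (rule bounded_subset) auto
    show "u absolutely_integrable_on {0<..<t}" by (rule L2_space_restrict_integrable[OF u t])
  qed simp
  then show ?thesis by (simp add: integrable_restrict_space set_integrable_def)
qed

lemma output_trajectory_comb:
  assumes "u \<in> L2_space (time_measure T)" "v \<in> L2_space (time_measure T)" "t \<le> T"
  shows "output_trajectory A B C (\<lambda>s. u s + c *\<^sub>R v s) t
       = output_trajectory A B C u t + c *\<^sub>R output_trajectory A B C v t"
  unfolding output_trajectory_def
  using assms
  by (simp add: matrix_vector_right_distrib matrix_vector_mult_scaleR output_integrand_integrable)

lemma L2_embedding_inj:
  assumes "L2_embedding M \<iota>" "AE t in M. \<iota> y t = \<iota> z t"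
  shows "y = z"
proof -
  have "AE t in M. \<iota> (y + (-1) *\<^sub>R z) t = \<iota> y t + \<iota> ((-1) *\<^sub>R z) t"
    "AE t in M. \<iota> ((-1) *\<^sub>R z) t = (-1) *\<^sub>R \<iota> z t"
    using assms(1) unfolding L2_embedding_def by blast+
  then have "AE t in M. \<iota> (y + (-1) *\<^sub>R z) t = 0"
    using assms(2) by eventually_elim simp
  then have "y + (-1) *\<^sub>R z = 0"
    using assms(1) unfolding L2_embedding_def by blast
  then show ?thesis by simp
qed

lemma output_operator_eqI:
  assumes "L2_embedding (time_measure T) \<iota>"
    and "AE t in time_measure T. \<iota> y t = output_trajectory A B C u t"
  shows "output_operator T A B C \<iota> u = y"
  unfolding output_operator_def
proof (rule the_equality)
  fix z
  assume "AE t in time_measure T. \<iota> z t = output_trajectory A B C u t"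
  with assms(2) have "AE t in time_measure T. \<iota> z t = \<iota> y t" by eventually_elim simp
  then show "z = y" by (rule L2_embedding_inj[OF assms(1)])
qed (rule assms(2))

text \<open>The output operator is a definite description. By injectivity of the embedding, any element with the
  right trajectory is the described one, and the combination of the two outputs has that trajectory.\<close>

lemma output_operator_comb:
  assumes emb: "L2_embedding (time_measure T) \<iota>"
    and wd: "\<forall>u \<in> L2_space (time_measure T).
           \<exists>y. AE t in time_measure T. \<iota> y t = output_trajectory A B C u t"
    and u: "u \<in> L2_space (time_measure T)" and v: "v \<in> L2_space (time_measure T)"
  shows "output_operator T A B C \<iota> (\<lambda>s. u s + c *\<^sub>R v s)
       = output_operator T A B C \<iota> u + c *\<^sub>R output_operator T A B C \<iota> v"
proof -
  obtain y z where y: "AE t in time_measure T. \<iota> y t = output_trajectory A B C u t"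
    and z: "AE t in time_measure T. \<iota> z t = output_trajectory A B C v t"
    using wd u v by blast
  have "AE t in time_measure T. \<iota> (y + c *\<^sub>R z) t = \<iota> y t + \<iota> (c *\<^sub>R z) t"
    "AE t in time_measure T. \<iota> (c *\<^sub>R z) t = c *\<^sub>R \<iota> z t"
    using emb unfolding L2_embedding_def by blast+
  moreover have "AE t in time_measure T. output_trajectory A B C (\<lambda>s. u s + c *\<^sub>R v s) t
      = output_trajectory A B C u t + c *\<^sub>R output_trajectory A B C v t"
    by (rule AE_I2) (auto intro!: output_trajectory_comb[OF u v])
  ultimately have "AE t in time_measure T. \<iota> (y + c *\<^sub>R z) t
      = output_trajectory A B C (\<lambda>s. u s + c *\<^sub>R v s) t"
    using y z by eventually_elim simp
  then show ?thesis
    using output_operator_eqI[OF emb y] output_operator_eqI[OF emb z]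
      output_operator_eqI[OF emb] by metis
qed

section \<open>Equivalent forms of exact output tracking controllability\<close>

theorem theorem2p4:
  fixes T :: real
    and A :: "real^'n^'n" and B :: "real^'m^'n" and C :: "real^'n^'p"
    and \<iota> :: "'y::{real_inner, complete_space} \<Rightarrow> real \<Rightarrow> real^'p"
  assumes "T > 0"
    and "CARD('m) \<le> CARD('n)" and "CARD('p) \<le> CARD('n)"
    and "rank C = CARD('p)"
    and embedded: "L2_embedding (time_measure T) \<iota>"
    and well_defined: "\<forall>u \<in> L2_space (time_measure T).
           \<exists>y. AE t in time_measure T. \<iota> y t = output_trajectory A B C u t"
    and continuous: "\<exists>K. \<forall>u \<in> L2_space (time_measure T).
           norm (output_operator T A B C \<iota> u) \<le> K * L2_norm (time_measure T) u"
  shows "(exactly_output_tracking_controllable T A B C \<iota> \<longleftrightarrow>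
            output_operator T A B C \<iota> ` L2_space (time_measure T) = UNIV)
       \<and> (output_operator T A B C \<iota> ` L2_space (time_measure T) = UNIV \<longleftrightarrow>
            (\<exists>\<gamma>>0. \<forall>\<psi> :: 'y \<Rightarrow>\<^sub>L real.
               norm \<psi> \<le> \<gamma> * L2_norm (time_measure T) (output_adjoint T A B C \<iota> \<psi>)))
       \<and> ((\<exists>\<gamma>>0. \<forall>\<psi> :: 'y \<Rightarrow>\<^sub>L real.
               norm \<psi> \<le> \<gamma> * L2_norm (time_measure T) (output_adjoint T A B C \<iota> \<psi>)) \<longleftrightarrow>
            bij (tracking_gramian T A B C \<iota>) \<and>
            continuous_on UNIV (inv (tracking_gramian T A B C \<iota>)))"
proof -
  obtain K where K: "\<And>u. u \<in> L2_space (time_measure T) \<Longrightarrow>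
      norm (output_operator T A B C \<iota> u) \<le> K * L2_norm (time_measure T) u"
    using continuous by blast
  interpret L2_operator "time_measure T" "output_operator T A B C \<iota>" "\<bar>K\<bar> + 1"
  proof
    fix u v :: "real \<Rightarrow> real^'m" and c
    assume u: "u \<in> L2_space (time_measure T)"
    have "K * L2_norm (time_measure T) u \<le> (\<bar>K\<bar> + 1) * L2_norm (time_measure T) u"
      by (intro mult_right_mono) (auto simp: L2_norm_def)
    then show "norm (output_operator T A B C \<iota> u) \<le> (\<bar>K\<bar> + 1) * L2_norm (time_measure T) u"
      using K[OF u] by linarith
    assume "v \<in> L2_space (time_measure T)"
    then show "output_operator T A B C \<iota> (fun_comb u c v)
        = output_operator T A B C \<iota> u + c *\<^sub>R output_operator T A B C \<iota> v"
      by (rule output_operator_comb[OF embedded well_defined u])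
  qed simp
  have adj_eq: "output_adjoint T A B C \<iota> = adj"
    by (simp add: output_adjoint_def)
  have gram_eq: "tracking_gramian T A B C \<iota> = gram"
    by (simp add: fun_eq_iff tracking_gramian_def gram_def adj_eq)
  have "exactly_output_tracking_controllable T A B C \<iota> \<longleftrightarrow>
      output_operator T A B C \<iota> ` L2_space (time_measure T) = UNIV"
    unfolding exactly_output_tracking_controllable_def set_eq_iff image_iff by (simp add: eq_commute)
  then show ?thesis
    unfolding adj_eq gram_eq using surjective_iff_coercive coercive_iff_gram_isomorphism by blast
qed

end
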